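(* Suppose that the following hold (notation in the context). (No anticipation) For all $g$, $t<T$ and $(d_1,\dots,d_T)\in\mathcal{D}$, $Y_{g,t}(d_1,\dots,d_T)$ does not depend on $(d_{t+1},\dots,d_T)$; it is denoted $Y_{g,t}(d_1,\dots,d_t)$. (i.i.d. groups) The variables $\big((Y_{g,1}(d_1),\dots,Y_{g,T}(d_1,\dots,d_T))_{(d_1,\dots,d_T)\in\mathcal{D}},\bm{D}_g\big)_{g\ge1}$ are i.i.d. (Parallel trends for the never-treated outcome) For all $t\ge2$, $E[Y_t(\bm{0}_t)-Y_{t-1}(\bm{0}_{t-1})\mid\bm{D}]=E[Y_t(\bm{0}_t)-Y_{t-1}(\bm{0}_{t-1})]$. (Random coefficients distributed-lag linear model) There exists a random vector $B=(\beta_0,\dots,\beta_K)'$ with $E[\|B\|^2]<\infty$ such that $$Y_t(d_1,\dots,d_t)=Y_t(\bm{0}_t)+\sum_{k=0}^{\min(K,t-1)}\beta_kd_{t-k},$$ where $K<T-1$ is known. (Condition on the design) $E[\Pi(\bm{M})]$ is invertible. (Moments) $E[\Delta D_t^2+\Delta Y_t(\bm{0}_t)^2]<\infty$ for all $t\ge2$. Then $\Gamma$ is identified by $$\Gamma=E[\Pi(\bm{M})]^{-1}E[\Pi(\bm{M})\Delta\bm{Y}].$$ Moreover, for $k\in\{0,\dots,K\}$, if $P(e_k\in\mathrm{Im}(\bm{M}'))>0$, then $\overline{\beta}_k:=E[\beta_k\mid e_k\in\mathrm{Im}(\bm{M}')]$ is identified by $$\overline{\beta}_k=\lim_{C\uparrow\infty}E\left[e_k'\bm{M}^+(\Delta\bm{Y}-\Gamma)\,\middle|\,e_k\in\mathrm{Im}(\bm{M}'),\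 \|\bm{M}'^{+}e_k\|\le C\right].$$ Finally, if $D_t$ is finitely supported for all $t=1,\dots,T$ (and $P(e_k\in\mathrm{Im}(\bm{M}'))>0$), then the expectation $E\left[e_k'\bm{M}^+(\Delta\bm{Y}-\Gamma)\mid e_k\in\mathrm{Im}(\bm{M}')\right]$ is well defined and $\overline{\beta}_k$ is identified by $$\overline{\beta}_k=E\left[e_k'\bm{M}^+(\Delta\bm{Y}-\Gamma)\,\middle|\,e_k\in\mathrm{Im}(\bm{M}')\right].$$
   Context: Setting. A panel of groups $g$ is observed at periods $t=1,\dots,T$. $D_{g,t}$ is the (real-valued) treatment of group $g$ at period $t$; $\bm{D}_g=(D_{g,1},\dots,D_{g,T})$ is the treatment path, with support $\mathcal{D}$ (not depending on $g$). $Y_{g,t}(d_1,\dots,d_T)$ is the potential outcome of group $g$ at $t$ under path $(d_1,\dots,d_T)$; the observed outcome is $Y_{g,t}=Y_{g,t}(D_{g,1},\dots,D_{g,t})$. The index $g$ is omitted, as groups are identically distributed. $\bm{0}_t$ is the vector of $t$ zeros; potential outcomes are understood to be defined for the zero path. No restriction is put on the dependence between $B$ and $\bm{D}$. A parameter is identified by a formula when it equals this formula, which depends only on the joint distribution of the observables $(Y_1,\dots,Y_T,\bm{D})$ (and on already identified parameters). $\Delta$ is the first-difference operator: $\Delta D_t=D_t-D_{t-1}$, $\Delta Y_t=Y_t-Y_{t-1}$, $\Delta Y_t(\bm{0}_t)=Y_t(\bm{0}_t)-Y_{t-1}(\bm{0}_{t-1})$. Let $\gamma_t=E[\Delta Y_t(\bm{0}_t)]$,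 $\Gamma=(\gamma_{K+2},\dots,\gamma_T)'$, $\Delta\bm{Y}=(\Delta Y_{K+2},\dots,\Delta Y_T)'$, and let $\bm{M}$ be the $(T-K-1)\times(K+1)$ random matrix $$\bm{M}=\begin{pmatrix}\Delta D_{K+2}&\dots&\Delta D_2\\ \Delta D_{K+3}&\dots&\Delta D_3\\ \vdots&&\vdots\\ \Delta D_T&\dots&\Delta D_{T-K}\end{pmatrix},$$ i.e. the row indexed by $t\in\{K+2,\dots,T\}$ is $(\Delta D_t,\Delta D_{t-1},\dots,\Delta D_{t-K})$. For a matrix $A$, $A'$ is its transpose, $A^+$ its Moore–Penrose inverse, $\mathrm{Im}(A)$ its image (column space), and $\Pi(A):=I-AA^+$ the orthogonal projector on the orthogonal complement of $\mathrm{Im}(A)$. $\bm{M}'^{+}$ denotes $(\bm{M}')^+$. $e_k$ is the $(k+1)$-th canonical basis vector of $\mathbb{R}^{K+1}$ (e.g. $e_0=(1,0,\dots,0)'$). $\|\cdot\|$ is the Euclidean norm. The limit in $C$ is over $C$ large enough for the conditioning event to have positive probability. *)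

theory Defs
  imports "HOL-Probability.Probability"
begin

section \<open>Moore--Penrose inverse, image and annihilator of a real matrix\<close>

definition moore_penrose :: "real ^ 'n ^ 'm \<Rightarrow> real ^ 'm ^ 'n \<Rightarrow> bool" where
  "moore_penrose A X \<longleftrightarrow>
     A ** X ** A = A \<and> X ** A ** X = X \<and>
     transpose (A ** X) = A ** X \<and> transpose (X ** A) = X ** A"

lemma moore_penrose_unique:
  assumes "moore_penrose A X" "moore_penrose A Z"
  shows "X = Z"
proof -
  have "A ** X = transpose (A ** X)" using assms(1) by (simp add: moore_penrose_def)
  also have "\<dots> = transpose ((A ** Z) ** (A ** X))"
    using assms(2) by (simp add: moore_penrose_def matrix_mul_assoc)
  also have "\<dots> = (A ** X) ** (A ** Z)"
    using assms by (simp add: moore_penrose_def matrix_transpose_mul)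
  also have "\<dots> = A ** Z" using assms(1) by (simp add: moore_penrose_def matrix_mul_assoc)
  finally have AX: "A ** X = A ** Z" .
  have "X ** A = transpose (X ** A)" using assms(1) by (simp add: moore_penrose_def)
  also have "\<dots> = transpose ((X ** A) ** (Z ** A))"
    using assms(2) by (simp add: moore_penrose_def flip: matrix_mul_assoc)
  also have "\<dots> = (Z ** A) ** (X ** A)"
    using assms by (simp add: moore_penrose_def matrix_transpose_mul)
  also have "\<dots> = Z ** A" using assms(1) by (simp add: moore_penrose_def flip: matrix_mul_assoc)
  finally have XA: "X ** A = Z ** A" .
  have "X = X ** (A ** X)" using assms(1) by (simp add: moore_penrose_def matrix_mul_assoc)
  also have "\<dots> = Z ** A ** Z" by (simp add: AX XA matrix_mul_assoc)
  also have "\<dots> = Z" using assms(2) by (simp add: moore_penrose_def)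
  finally show ?thesis .
qed

lemma moore_penrose_exists: "\<exists>X. moore_penrose A X"
proof -
  let ?N = "{x. A *v x = 0}" and ?R = "range ((*v) A)"
  have N: "subspace ?N" by (rule linear_subspace_kernel) simp
  have R: "subspace ?R" by (rule linear_subspace_image) simp_all
  define Q where "Q y x \<longleftrightarrow> (\<forall>n\<in>?N. x \<bullet> n = 0) \<and> (\<forall>r\<in>?R. (y - A *v x) \<bullet> r = 0)" for y x
  have ex: "\<exists>x. Q y x" for y
  proof -
    obtain r s where r: "r \<in> span ?R" and s: "\<And>w. w \<in> span ?R \<Longrightarrow> orthogonal s w" and y: "y = r + s"
      using orthogonal_subspace_decomp_exists[of ?R y] by metis
    have "r \<in> ?R" using r R by (metis span_eq_iff)
    then obtain x0 where x0: "r = A *v x0" by blast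
    obtain n v where n: "n \<in> span ?N" and v: "\<And>w. w \<in> span ?N \<Longrightarrow> orthogonal v w" and x: "x0 = n + v"
      using orthogonal_subspace_decomp_exists[of ?N x0] by metis
    have "A *v n = 0" using n N by (metis (mono_tags, lifting) mem_Collect_eq span_eq_iff)
    then have "A *v v = r" by (simp add: x0 x matrix_vector_right_distrib)
    then have "Q y v"
      using v s unfolding Q_def orthogonal_def by (simp add: y span_base)
    then show ?thesis ..
  qed
  have uniq: "x = x'" if "Q y x" "Q y x'" for x x' y
  proof -
    have "(A *v (x - x')) \<bullet> r = 0" if "r \<in> ?R" for r
      using \<open>Q y x\<close> \<open>Q y x'\<close> that unfolding Q_def
      by (auto simp: matrix_vector_mult_diff_distrib inner_diff_left)
    then have "(A *v (x - x')) \<bullet> (A *v (x - x')) = 0" by blast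
    then have "A *v (x - x') = 0" by simp
    then have "x - x' \<in> ?N" by simp
    then have "x \<bullet> (x - x') = 0" "x' \<bullet> (x - x') = 0"
      using that unfolding Q_def by blast+
    then have "(x - x') \<bullet> (x - x') = 0" by (simp add: inner_diff_left)
    then show ?thesis by simp
  qed
  define g where "g y = (THE x. Q y x)" for y
  have g: "Q y (g y)" for y
    unfolding g_def using ex uniq by (metis theI)
  have lin: "linear g"
  proof (rule linearI)
    show "g (a + b) = g a + g b" for a b
    proof (rule uniq[OF g])
      show "Q (a + b) (g a + g b)"
        using g[of a] g[of b] unfolding Q_def
        by (auto simp: inner_add_left inner_diff_left matrix_vector_right_distrib)
    qed
    show "g (c *\<^sub>R a) = c *\<^sub>R g a" for c a
    proof (rule uniq[OF g])
      show "Q (c *\<^sub>R a) (c *\<^sub>R g a)"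
        using g[of a] unfolding Q_def
        by (auto simp: inner_diff_left matrix_vector_mult_scaleR simp flip: right_diff_distrib)
    qed
  qed
  define X where "X = matrix g"
  have X: "X *v y = g y" for y
    unfolding X_def using lin by (simp add: matrix_works linear_matrix_vector_mul_eq)
  have QX: "Q y (X *v y)" for y using g X by simp
  have AXA: "A *v (X *v (A *v x)) = A *v x" for x
  proof -
    have "(A *v x - A *v (X *v (A *v x))) \<bullet> (A *v (x - X *v (A *v x))) = 0"
      using QX[of "A *v x"] unfolding Q_def by blast
    then show ?thesis by (simp add: matrix_vector_mult_diff_distrib)
  qed
  have XAX: "X *v (A *v (X *v y)) = X *v y" for y
  proof (rule uniq[OF QX])
    show "Q (A *v (X *v y)) (X *v y)" using QX[of y] unfolding Q_def by simp
  qed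
  have sAX: "(A *v (X *v y)) \<bullet> z = y \<bullet> (A *v (X *v z))" for y z
  proof -
    have "(z - A *v (X *v z)) \<bullet> (A *v (X *v y)) = 0"
      "(y - A *v (X *v y)) \<bullet> (A *v (X *v z)) = 0"
      using QX[of y] QX[of z] unfolding Q_def by blast+
    then show ?thesis
      using inner_commute[of "A *v (X *v z)" "A *v (X *v y)"]
        inner_commute[of z "A *v (X *v y)"] by (simp add: inner_diff_left)
  qed
  have sXA: "(X *v (A *v y)) \<bullet> z = y \<bullet> (X *v (A *v z))" for y z
  proof -
    have "z - X *v (A *v z) \<in> ?N" "y - X *v (A *v y) \<in> ?N"
      by (simp_all add: matrix_vector_mult_diff_distrib AXA)
    then have "(X *v (A *v y)) \<bullet> (z - X *v (A *v z)) = 0"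
      "(X *v (A *v z)) \<bullet> (y - X *v (A *v y)) = 0"
      using QX[of "A *v y"] QX[of "A *v z"] unfolding Q_def by blast+
    then show ?thesis
      using inner_commute[of "X *v (A *v z)" "X *v (A *v y)"]
        inner_commute[of y "X *v (A *v z)"] by (simp add: inner_diff_right)
  qed
  have sym: "transpose C = C" if "\<And>y z. (C *v y) \<bullet> z = y \<bullet> (C *v z)" for C :: "real ^ 'k ^ 'k"
  proof -
    have "(transpose C *v y) \<bullet> z = (C *v y) \<bullet> z" for y z
      using that[of y z] by (simp add: dot_lmul_matrix flip: vector_transpose_matrix)
    then have "transpose C *v y = C *v y" for y using vector_eq_rdot by blast
    then show ?thesis unfolding matrix_eq by blast
  qed
  have "transpose (A ** X) = A ** X" "transpose (X ** A) = X ** A"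
    by (rule sym; simp add: sAX sXA flip: matrix_vector_mul_assoc)+
  moreover have "A ** X ** A = A" "X ** A ** X = X"
    by (simp_all add: matrix_eq AXA XAX flip: matrix_vector_mul_assoc)
  ultimately have "moore_penrose A X" by (simp add: moore_penrose_def)
  then show ?thesis ..
qed

definition pinv :: "real ^ 'n ^ 'm \<Rightarrow> real ^ 'm ^ 'n" where
  "pinv A = (THE X. moore_penrose A X)"

lemma moore_penrose_pinv: "moore_penrose A (pinv A)"
  unfolding pinv_def by (metis moore_penrose_exists moore_penrose_unique theI)

definition mat_image :: "real ^ 'n ^ 'm \<Rightarrow> (real ^ 'm) set" where
  "mat_image A = range (\<lambda>x. A *v x)"

definition annihilator :: "real ^ 'n ^ 'm \<Rightarrow> real ^ 'm ^ 'm" where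
  "annihilator A = mat 1 - A ** pinv A"


section \<open>Conditioning on an event\<close>

text \<open>\<^term>\<open>uniform_measure M A\<close> is the conditional probability given the event \<open>A\<close>.\<close>

definition cond_expectation :: "'w measure \<Rightarrow> ('w \<Rightarrow> real) \<Rightarrow> 'w set \<Rightarrow> real" where
  "cond_expectation M X A = (\<integral>\<omega>. X \<omega> \<partial>uniform_measure M A)"


section \<open>Panel data\<close>

text \<open>
  A path \<open>(d\<^sub>1, \<dots>, d\<^sub>T)\<close> is an extensional function on \<open>{1..T}\<close>.  Potential outcomes
  \<open>Y g t d \<omega>\<close> and treatments \<open>D g t \<omega>\<close> carry the group \<open>g\<close> and the period \<open>t\<close>; a potential
  outcome takes the full path \<open>d\<close> as argument, so that the absence of anticipation is a
  hypothesis on \<open>Y\<close> and \<open>Y\<^sub>t(0\<^sub>t)\<close> is \<open>Y g t (zero_path T)\<close>.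
\<close>

type_synonym path = "nat \<Rightarrow> real"

definition path_space :: "nat \<Rightarrow> path measure" where
  "path_space T = PiM {1..T} (\<lambda>_. borel)"

definition zero_path :: "nat \<Rightarrow> path" where
  "zero_path T = (\<lambda>t\<in>{1..T}. 0)"

definition treatment_path :: "nat \<Rightarrow> (nat \<Rightarrow> nat \<Rightarrow> 'w \<Rightarrow> real) \<Rightarrow> nat \<Rightarrow> 'w \<Rightarrow> path" where
  "treatment_path T D g \<omega> = (\<lambda>t\<in>{1..T}. D g t \<omega>)"

text \<open>The topological support of the distribution of the treatment path.\<close>

definition path_support :: "'w measure \<Rightarrow> nat \<Rightarrow> (nat \<Rightarrow> nat \<Rightarrow> 'w \<Rightarrow> real) \<Rightarrow> nat \<Rightarrow> path set" where
  "path_support M T D g =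
     {d \<in> space (path_space T). \<forall>\<epsilon>>0.
        measure M {\<omega> \<in> space M. \<forall>t\<in>{1..T}. \<bar>D g t \<omega> - d t\<bar> < \<epsilon>} > 0}"

definition outcome_path ::
  "nat \<Rightarrow> (nat \<Rightarrow> nat \<Rightarrow> path \<Rightarrow> 'w \<Rightarrow> real) \<Rightarrow> (nat \<Rightarrow> nat \<Rightarrow> 'w \<Rightarrow> real) \<Rightarrow> nat \<Rightarrow> 'w \<Rightarrow> path" where
  "outcome_path T Y D g \<omega> = (\<lambda>t\<in>{1..T}. Y g t (treatment_path T D g \<omega>) \<omega>)"

text \<open>All potential outcomes of a group together with its treatment path.  The zero path is
  added since it need not belong to the support.\<close>

definition group_space :: "nat \<Rightarrow> path set \<Rightarrow> ((nat \<times> path \<Rightarrow> real) \<times> path) measure" where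
  "group_space T \<D> = PiM ({1..T} \<times> insert (zero_path T) \<D>) (\<lambda>_. borel) \<Otimes>\<^sub>M path_space T"

definition group_data ::
  "nat \<Rightarrow> path set \<Rightarrow> (nat \<Rightarrow> nat \<Rightarrow> path \<Rightarrow> 'w \<Rightarrow> real) \<Rightarrow> (nat \<Rightarrow> nat \<Rightarrow> 'w \<Rightarrow> real) \<Rightarrow> nat
    \<Rightarrow> 'w \<Rightarrow> (nat \<times> path \<Rightarrow> real) \<times> path" where
  "group_data T \<D> Y D g \<omega> =
     ((\<lambda>(t, d)\<in>{1..T} \<times> insert (zero_path T) \<D>. Y g t d \<omega>), treatment_path T D g \<omega>)"

text \<open>The joint distribution of the observables \<open>((Y\<^sub>1, \<dots>, Y\<^sub>T), (D\<^sub>1, \<dots>, D\<^sub>T))\<close> of group \<open>g\<close>.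
  A parameter is identified when it is equal to a functional of this measure.\<close>

definition obs_law ::
  "'w measure \<Rightarrow> nat \<Rightarrow> (nat \<Rightarrow> nat \<Rightarrow> path \<Rightarrow> 'w \<Rightarrow> real) \<Rightarrow> (nat \<Rightarrow> nat \<Rightarrow> 'w \<Rightarrow> real) \<Rightarrow> nat
    \<Rightarrow> (path \<times> path) measure" where
  "obs_law M T Y D g =
     distr M (path_space T \<Otimes>\<^sub>M path_space T)
       (\<lambda>\<omega>. (outcome_path T Y D g \<omega>, treatment_path T D g \<omega>))"


section \<open>First differences and the design matrix\<close>

text \<open>
  Matrix rows are indexed by a finite type \<open>'r\<close> labelled by the periods \<open>{K+2..T}\<close>, columns by a finite
  type \<open>'c\<close> labelled by the lags \<open>{0..K}\<close>; the labellings \<open>period\<close> and \<open>lag\<close> are bijections.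
\<close>

definition fdiff :: "path \<Rightarrow> nat \<Rightarrow> real" where
  "fdiff x t = x t - x (t - 1)"

definition diff_vec :: "('r::finite \<Rightarrow> nat) \<Rightarrow> path \<Rightarrow> real ^ 'r" where
  "diff_vec period y = (\<chi> i. fdiff y (period i))"

definition design_matrix ::
  "('r::finite \<Rightarrow> nat) \<Rightarrow> ('c::finite \<Rightarrow> nat) \<Rightarrow> path \<Rightarrow> real ^ 'c ^ 'r" where
  "design_matrix period lag d = (\<chi> i j. fdiff d (period i - lag j))"

text \<open>\<open>e\<^sub>k \<in> Im(M')\<close>\<close>

definition lag_estimable ::
  "('r::finite \<Rightarrow> nat) \<Rightarrow> ('c::finite \<Rightarrow> nat) \<Rightarrow> 'c \<Rightarrow> path \<Rightarrow> bool" where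
  "lag_estimable period lag k d \<longleftrightarrow> axis k 1 \<in> mat_image (transpose (design_matrix period lag d))"

text \<open>\<open>e\<^sub>k' M\<^sup>+ (\<Delta>Y - \<Gamma>)\<close>\<close>

definition lag_score ::
  "('r::finite \<Rightarrow> nat) \<Rightarrow> ('c::finite \<Rightarrow> nat) \<Rightarrow> 'c \<Rightarrow> real ^ 'r \<Rightarrow> path \<Rightarrow> path \<Rightarrow> real" where
  "lag_score period lag k \<Gamma> y d =
     axis k 1 \<bullet> (pinv (design_matrix period lag d) *v (diff_vec period y - \<Gamma>))"

definition Gamma_param ::
  "'w measure \<Rightarrow> nat \<Rightarrow> (nat \<Rightarrow> nat \<Rightarrow> path \<Rightarrow> 'w \<Rightarrow> real) \<Rightarrow> nat \<Rightarrow> ('r::finite \<Rightarrow> nat) \<Rightarrow> real ^ 'r" where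
  "Gamma_param M T Y g period =
     (\<chi> i. \<integral>\<omega>. Y g (period i) (zero_path T) \<omega> - Y g (period i - 1) (zero_path T) \<omega> \<partial>M)"

definition beta_bar ::
  "'w measure \<Rightarrow> nat \<Rightarrow> (nat \<Rightarrow> nat \<Rightarrow> 'w \<Rightarrow> real) \<Rightarrow> ('w \<Rightarrow> real ^ 'c) \<Rightarrow> nat
    \<Rightarrow> ('r::finite \<Rightarrow> nat) \<Rightarrow> ('c::finite \<Rightarrow> nat) \<Rightarrow> 'c \<Rightarrow> real" where
  "beta_bar M T D B g period lag k =
     cond_expectation M (\<lambda>\<omega>. B \<omega> $ k)
       {\<omega> \<in> space M. lag_estimable period lag k (treatment_path T D g \<omega>)}"

end

theory Submission
  imports Defs
begin

text \<open>
  Almost surely the treatment path lies in its support, so the model gives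
  \<open>\<Delta>Y = W + M B\<close> with \<open>W\<close> the differenced never-treated outcomes.  The annihilator \<open>\<Pi>(M)\<close>
  removes \<open>M B\<close>, and parallel trends replace \<open>W\<close> by \<open>\<Gamma>\<close> under any bounded weight depending
  on the treatments only, whence \<open>E[\<Pi>(M) \<Delta>Y] = E[\<Pi>(M)] \<Gamma>\<close>.

  For the coefficients put \<open>q = M'\<^sup>+ e\<^sub>k\<close>.  Then \<open>e\<^sub>k' M\<^sup>+ v = q \<bullet> v\<close>, and \<open>M' q = e\<^sub>k\<close> whenever
  \<open>e\<^sub>k \<in> Im(M')\<close>, so that the score is \<open>\<beta>\<^sub>k + q \<bullet> (W - \<Gamma>)\<close> on this event.  On \<open>\<parallel>q\<parallel> \<le> C\<close> the
  weight \<open>q\<close> is bounded and the second term has mean zero; dominated convergence lets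
  \<open>C \<rightarrow> \<infinity>\<close>, and for finitely supported treatments \<open>q\<close> is bounded outright.

  The Moore--Penrose inverse is discontinuous; it is Borel because its graph is closed.
\<close>

section \<open>Measurability of the Moore--Penrose inverse\<close>

text \<open>Projection along a compact factor preserves closedness. Cutting a closed set of values
  into its intersections with balls of integer radius therefore makes its preimage a countable union
  of closed sets.\<close>

lemma borel_measurable_closed_graph:
  fixes f :: "'a::euclidean_space \<Rightarrow> 'b::euclidean_space"
  assumes "closed {(y, x). y = f x}"
  shows "f \<in> borel_measurable borel"
proof -
  have "f \<in> borel \<rightarrow>\<^sub>M sigma UNIV (Collect closed)"
  proof (rule measurable_measure_of)
    show "f -` S \<inter> space borel \<in> sets borel" if "S \<in> Collect closed" for S
    proof -
      \<comment> \<open>The value is the component projected away;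
        \<open>S \<inter> cball 0 (real n)\<close> is the compact factor it ranges over.\<close>
      have "closed {x. \<exists>y. y \<in> S \<inter> cball 0 (real n) \<and> (y, x) \<in> {(y, x). y = f x}}" (is "closed (?T n)") for n
        using that by (intro closed_compact_projection assms closed_Int_compact) auto
      moreover have "f -` S = (\<Union>n. ?T n)" by (auto simp: real_arch_simple)
      ultimately show ?thesis by auto
    qed
  qed auto
  then show ?thesis by (simp add: borel_eq_closed)
qed

lemma continuous_on_matrix_mult [continuous_intros]:
  fixes F :: "'a::topological_space \<Rightarrow> real ^ 'n ^ 'm" and G :: "'a \<Rightarrow> real ^ 'p ^ 'n"
  assumes "continuous_on S F" "continuous_on S G"
  shows "continuous_on S (\<lambda>x. F x ** G x)"
  unfolding matrix_matrix_mult_def by (intro continuous_intros assms)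

lemma continuous_on_transpose [continuous_intros]:
  fixes F :: "'a::topological_space \<Rightarrow> real ^ 'n ^ 'm"
  assumes "continuous_on S F"
  shows "continuous_on S (\<lambda>x. transpose (F x))"
  unfolding transpose_def by (intro continuous_intros assms)

lemma moore_penrose_iff_pinv: "moore_penrose A X \<longleftrightarrow> X = pinv A"
  using moore_penrose_pinv moore_penrose_unique by blast

text \<open>The four Penrose equations are jointly continuous in both matrices, and by existence and
  uniqueness their solution set is exactly the graph.\<close>

lemma borel_measurable_pinv [measurable]: "pinv \<in> borel_measurable borel"
proof (rule borel_measurable_closed_graph)
  have "closed {z :: (real ^ 'm ^ 'n) \<times> (real ^ 'n ^ 'm). moore_penrose (snd z) (fst z)}"
    unfolding moore_penrose_def by (intro closed_Collect_conj closed_Collect_eq continuous_intros)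
  then show "closed {(X, A :: real ^ 'n ^ 'm). X = pinv A}"
    by (simp add: moore_penrose_iff_pinv split_def)
qed

lemma borel_measurable_matrix_mult [measurable (raw)]:
  fixes F :: "'a \<Rightarrow> real ^ 'n ^ 'm" and G :: "'a \<Rightarrow> real ^ 'p ^ 'n"
  assumes "F \<in> borel_measurable M" "G \<in> borel_measurable M"
  shows "(\<lambda>x. F x ** G x) \<in> borel_measurable M"
  using assms by (rule borel_measurable_continuous_Pair) (intro continuous_intros)

lemma borel_measurable_matrix_vector_mult [measurable (raw)]:
  fixes F :: "'a \<Rightarrow> real ^ 'n ^ 'm" and G :: "'a \<Rightarrow> real ^ 'n"
  assumes "F \<in> borel_measurable M" "G \<in> borel_measurable M"
  shows "(\<lambda>x. F x *v G x) \<in> borel_measurable M"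
  using assms
  by (rule borel_measurable_continuous_Pair)
    (unfold matrix_vector_mult_def, intro continuous_intros)

lemma borel_measurable_transpose [measurable]:
  "(transpose :: real ^ 'n ^ 'm \<Rightarrow> _) \<in> borel_measurable borel"
  by (intro borel_measurable_continuous_onI continuous_intros)

lemma borel_measurable_annihilator [measurable]:
  "(annihilator :: real ^ 'n ^ 'm \<Rightarrow> _) \<in> borel_measurable borel"
  unfolding annihilator_def by measurable

lemma borel_measurable_vec_nth [measurable (raw)]:
  fixes f :: "'a \<Rightarrow> 'b::euclidean_space ^ 'n"
  assumes "f \<in> borel_measurable M"
  shows "(\<lambda>x. f x $ i) \<in> borel_measurable M"
  using assms by (rule borel_measurable_continuous_on[rotated]) (intro continuous_intros)

lemma borel_measurable_vec_lambda:
  fixes f :: "'a \<Rightarrow> 'n::finite \<Rightarrow> 'b::euclidean_space"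
  assumes [measurable]: "\<And>i. (\<lambda>x. f x i) \<in> borel_measurable M"
  shows "(\<lambda>x. \<chi> i. f x i) \<in> borel_measurable M"
  by (subst borel_measurable_euclidean_space) (auto simp: Basis_vec_def inner_axis)

section \<open>Algebra of the Moore--Penrose inverse\<close>

text \<open>Transposition permutes the four Penrose equations, so uniqueness applies.\<close>

lemma pinv_transpose: "pinv (transpose A) = transpose (pinv A)"
proof -
  have "moore_penrose (transpose A) (transpose (pinv A))"
    using moore_penrose_pinv[of A] unfolding moore_penrose_def
    by (metis matrix_transpose_mul matrix_mul_assoc)
  then show ?thesis by (simp add: moore_penrose_iff_pinv)
qed

lemma mult_pinv_mult: "A *v (pinv A *v (A *v x)) = A *v x"
proof -
  have "A ** pinv A ** A = A" using moore_penrose_pinv[of A] by (simp add: moore_penrose_def)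
  then show ?thesis by (simp only: matrix_vector_mul_assoc matrix_mul_assoc)
qed

text \<open>\<open>A ** pinv A\<close> is a projector whose fixed points are the image. This
  replaces an existential condition by an equation between Borel functions, which makes the event
  \<open>e_k \<in> Im(M')\<close> measurable.\<close>

lemma mem_mat_image_iff: "v \<in> mat_image A \<longleftrightarrow> A *v (pinv A *v v) = v"
proof
  assume "v \<in> mat_image A"
  then show "A *v (pinv A *v v) = v"
    by (auto simp: mat_image_def mult_pinv_mult)
next
  assume "A *v (pinv A *v v) = v"
  then show "v \<in> mat_image A" unfolding mat_image_def by (metis rangeI)
qed

lemma annihilator_mult_vec: "annihilator A *v x = x - A *v (pinv A *v x)"
  by (simp add: annihilator_def matrix_vector_mult_diff_rdistrib matrix_vector_mul_assoc)

lemma annihilator_mult_image: "annihilator A *v (A *v x) = 0"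
  by (simp add: annihilator_mult_vec mult_pinv_mult)

text \<open>Since \<open>A ** pinv A\<close> is symmetric and idempotent, the projection
  \<open>p\<close> is orthogonal to the residual \<open>x - p\<close>, and Pythagoras
  applies.\<close>

lemma norm_annihilator_le: "norm (annihilator A *v x) \<le> norm x"
proof -
  define p where "p = A *v (pinv A *v x)"
  have sym: "transpose (A ** pinv A) = A ** pinv A"
    using moore_penrose_pinv[of A] by (simp add: moore_penrose_def)
  have idem: "A *v (pinv A *v p) = p" by (simp add: p_def mult_pinv_mult)
  have "(A *v (pinv A *v x)) \<bullet> y = x \<bullet> (A *v (pinv A *v y))" for y
    using vector_transpose_matrix[of x "A ** pinv A"] dot_lmul_matrix[of x "A ** pinv A" y]
    by (simp only: sym matrix_vector_mul_assoc)
  then have "p \<bullet> p = x \<bullet> (A *v (pinv A *v p))"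
    unfolding p_def .
  then have "(x - p) \<bullet> p = 0" by (simp add: idem inner_diff_left)
  then have "(norm (x - p))\<^sup>2 \<le> (norm x)\<^sup>2"
    by (simp add: inner_diff inner_commute power2_norm_eq_inner)
  then show ?thesis by (simp add: annihilator_mult_vec p_def)
qed

text \<open>An entry is a coordinate of the contraction applied to a unit vector. The bound is
  uniform in \<open>A\<close>, so the annihilator of a random matrix is a bounded weight.\<close>

lemma abs_annihilator_entry_le: "\<bar>annihilator A $ i $ j\<bar> \<le> 1"
proof -
  have "\<bar>(annihilator A *v axis j 1) $ i\<bar> \<le> norm (annihilator A *v axis j 1)"
    by (rule component_le_norm_cart)
  also have "\<dots> \<le> 1" using norm_annihilator_le[of A "axis j 1"] by simp
  finally show ?thesis by (simp add: matrix_vector_mult_basis column_def)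
qed

section \<open>Integrals\<close>

lemma integrable_vecI:
  fixes f :: "'a \<Rightarrow> 'b::euclidean_space ^ 'n"
  assumes "\<And>i. integrable M (\<lambda>x. f x $ i)"
  shows "integrable M f"
proof -
  have "integrable M (\<lambda>x. \<Sum>i\<in>UNIV. axis i (f x $ i))"
    by (intro Bochner_Integration.integrable_sum integrable_bounded_linear[OF _ assms])
      (auto intro!: linear_conv_bounded_linear[THEN iffD1] linearI simp: axis_def vec_eq_iff)
  moreover have "(\<lambda>x. \<Sum>i\<in>UNIV. axis i (f x $ i)) = f"
    by (auto simp: fun_eq_iff vec_eq_iff axis_def if_distrib[of "\<lambda>v. v $ _"] cong: if_cong)
  ultimately show ?thesis by simp
qed

lemma integral_vec_nth:
  fixes f :: "'a \<Rightarrow> 'b::euclidean_space ^ 'n"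
  assumes "integrable M f"
  shows "(\<integral>x. f x \<partial>M) $ i = (\<integral>x. f x $ i \<partial>M)"
  using integral_bounded_linear[OF bounded_linear_vec_nth assms] by simp

text \<open>The conditional law has density \<open>indicator S / measure M S\<close>, so conditional
  statements reduce to integrals of \<open>indicator S x * f x\<close> under
  \<open>M\<close>.\<close>

lemma (in finite_measure)
  fixes f :: "'a \<Rightarrow> real"
  assumes S: "S \<in> sets M" "measure M S > 0" and f: "f \<in> borel_measurable M"
  shows integrable_uniform_measure_iff:
      "integrable (uniform_measure M S) f \<longleftrightarrow> integrable M (\<lambda>x. indicator S x * f x)"
    and cond_expectation_eq:
      "cond_expectation M f S = (\<integral>x. indicator S x * f x \<partial>M) / measure M S"
proof -
  define c where "c = measure M S"
  have c: "c > 0" using S by (simp add: c_def)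
  have eq: "uniform_measure M S = density M (\<lambda>x. ennreal (indicator S x / c))"
    unfolding uniform_measure_def using c S
    by (intro density_cong)
      (auto simp: emeasure_eq_measure divide_ennreal c_def[symmetric] simp flip: ennreal_indicator)
  have m: "(\<lambda>x. indicator S x / c) \<in> borel_measurable M" "AE x in M. 0 \<le> indicator S x / c"
    using S c by auto
  show "integrable (uniform_measure M S) f \<longleftrightarrow> integrable M (\<lambda>x. indicator S x * f x)"
    using c integrable_mult_left_iff[of M "1 / c" "\<lambda>x. indicator S x * f x"]
    by (simp add: eq integrable_density[OF f m])
  show "cond_expectation M f S = (\<integral>x. indicator S x * f x \<partial>M) / measure M S"
    unfolding cond_expectation_def by (simp add: eq integral_density[OF f m] flip: c_def)
qed

text \<open>Mean independence lets \<open>W\<close> be replaced by its mean under any bounded weight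
  that is a function of \<open>X\<close>. The bound on the weight makes the product
  integrable.\<close>

lemma (in prob_space)
  fixes h :: "'b \<Rightarrow> real"
  assumes X [measurable]: "X \<in> M \<rightarrow>\<^sub>M N" and h [measurable]: "h \<in> borel_measurable N"
    and W: "integrable M W"
    and mean_indep: "AE \<omega> in M. real_cond_exp M (vimage_algebra (space M) X N) W \<omega> = c"
    and bound: "AE \<omega> in M. \<bar>h (X \<omega>)\<bar> \<le> C"
  shows integrable_mult_mean_independent: "integrable M (\<lambda>\<omega>. h (X \<omega>) * W \<omega>)"
    and integral_mult_mean_independent:
      "(\<integral>\<omega>. h (X \<omega>) * W \<omega> \<partial>M) = (\<integral>\<omega>. h (X \<omega>) * c \<partial>M)"
proof -
  let ?F = "vimage_algebra (space M) X N"
  have "subalgebra M ?F"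
    unfolding subalgebra_def using measurable_space[OF X] measurable_sets[OF X]
    by (auto simp: sets_vimage_algebra2 Pi_iff)
  then interpret finite_measure_subalgebra M ?F
    by unfold_locales
  have [measurable]: "W \<in> borel_measurable M" using W by simp
  show int: "integrable M (\<lambda>\<omega>. h (X \<omega>) * W \<omega>)"
  proof (rule Bochner_Integration.integrable_bound)
    show "integrable M (\<lambda>\<omega>. C * W \<omega>)" using W by simp
    show "AE \<omega> in M. norm (h (X \<omega>) * W \<omega>) \<le> norm (C * W \<omega>)"
      using bound by eventually_elim (auto simp: abs_mult intro!: mult_right_mono)
  qed measurable
  \<comment> \<open>Measurability with respect to the sigma-algebra generated by \<open>X\<close> is
    what allows the weight to be pulled out of the conditional expectation.\<close>
  have "X \<in> ?F \<rightarrow>\<^sub>M N"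
    using measurable_space[OF X] by (intro measurable_vimage_algebra1) auto
  then have "(\<lambda>\<omega>. h (X \<omega>)) \<in> borel_measurable ?F" by measurable
  from real_cond_exp_intg(2)[OF int this]
  have "(\<integral>\<omega>. h (X \<omega>) * W \<omega> \<partial>M) = (\<integral>\<omega>. h (X \<omega>) * real_cond_exp M ?F W \<omega> \<partial>M)"
    by simp
  also have "\<dots> = (\<integral>\<omega>. h (X \<omega>) * c \<partial>M)"
    using mean_indep by (intro integral_cong_AE) auto
  finally show "(\<integral>\<omega>. h (X \<omega>) * W \<omega> \<partial>M) = (\<integral>\<omega>. h (X \<omega>) * c \<partial>M)" .
qed

section \<open>Regression with random coefficients\<close>

text \<open>The vector \<open>q\<close> of the overview: the least-norm solution of
  \<open>A' q = e_k\<close> when there is one. It depends on the design only.\<close>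

definition coef_weight :: "'c \<Rightarrow> real ^ 'c ^ 'r \<Rightarrow> real ^ 'r" where
  "coef_weight k A = pinv (transpose A) *v axis k 1"

lemma borel_measurable_coef_weight [measurable]: "coef_weight k \<in> borel_measurable borel"
  unfolding coef_weight_def by measurable

lemma inner_pinv_eq_coef_weight: "axis k 1 \<bullet> (pinv A *v v) = coef_weight k A \<bullet> v"
  by (simp add: coef_weight_def pinv_transpose vector_transpose_matrix flip: dot_lmul_matrix)

text \<open>Moving \<open>A\<close> across the inner product gives
  \<open>(A' q) \<bullet> b\<close>, and \<open>A' q = e_k\<close> by the projector criterion for
  the image.\<close>

lemma coef_weight_inner_mult:
  assumes "axis k 1 \<in> mat_image (transpose A)"
  shows "coef_weight k A \<bullet> (A *v b) = b $ k"
proof -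
  have "coef_weight k A \<bullet> (A *v b) = (transpose A *v coef_weight k A) \<bullet> b"
    by (simp only: transpose_matrix_vector dot_lmul_matrix)
  also have "\<dots> = b $ k"
    using assms by (simp only: coef_weight_def mem_mat_image_iff inner_axis' inner_real_def mult_1)
  finally show ?thesis .
qed

text \<open>The panel reduced to a linear regression: \<open>X\<close> determines the design,
  \<open>V\<close> is the raw outcome, and \<open>f\<close> turns it into the regressand. Keeping
  \<open>V\<close> and \<open>f\<close> apart allows formulas to be stated under the joint law of
  \<open>(V, X)\<close>, which is the form identification takes. The error is mean independent of
  \<open>X\<close>, while \<open>B\<close> may depend on \<open>X\<close>.\<close>

locale random_coefficient_regression = prob_space M
  for M :: "'w measure" +
  fixes N :: "'x measure" and X :: "'w \<Rightarrow> 'x" and A :: "'x \<Rightarrow> real ^ 'c::finite ^ 'r::finite"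
    and L :: "'y measure" and V :: "'w \<Rightarrow> 'y" and f :: "'y \<Rightarrow> real ^ 'r"
    and W :: "'w \<Rightarrow> real ^ 'r" and \<gamma> :: "real ^ 'r" and B :: "'w \<Rightarrow> real ^ 'c"
  assumes X [measurable]: "X \<in> M \<rightarrow>\<^sub>M N" and A [measurable]: "A \<in> borel_measurable N"
    and V [measurable]: "V \<in> M \<rightarrow>\<^sub>M L" and f [measurable]: "f \<in> borel_measurable L"
    and W: "integrable M W" and B: "integrable M B"
    and mean_indep: "\<And>i. AE \<omega> in M.
      real_cond_exp M (vimage_algebra (space M) X N) (\<lambda>\<omega>. W \<omega> $ i) \<omega> = \<gamma> $ i"
    and regression: "AE \<omega> in M. f (V \<omega>) = W \<omega> + A (X \<omega>) *v B \<omega>"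
begin

abbreviation observation :: "('y \<times> 'x) measure" where
  "observation \<equiv> distr M (L \<Otimes>\<^sub>M N) (\<lambda>\<omega>. (V \<omega>, X \<omega>))"

lemma B_measurable [measurable]: "B \<in> borel_measurable M"
  and W_measurable [measurable]: "W \<in> borel_measurable M"
  using B W by auto

lemma integrable_nth: "integrable M (\<lambda>\<omega>. W \<omega> $ i)" "integrable M (\<lambda>\<omega>. B \<omega> $ j)"
  using integrable_bounded_linear[OF bounded_linear_vec_nth] W B by auto

text \<open>Coordinatewise application of mean independence, each coordinate of \<open>h\<close>
  being bounded by the norm of \<open>h\<close>.\<close>

lemma
  assumes h [measurable]: "h \<in> borel_measurable N"
    and bound: "AE \<omega> in M. norm (h (X \<omega>)) \<le> C"
  shows integrable_weighted_error: "integrable M (\<lambda>\<omega>. h (X \<omega>) \<bullet> (W \<omega> - \<gamma>))"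
    and integral_weighted_error: "(\<integral>\<omega>. h (X \<omega>) \<bullet> (W \<omega> - \<gamma>) \<partial>M) = 0"
proof -
  have eq: "h (X \<omega>) \<bullet> (W \<omega> - \<gamma>) = (\<Sum>i\<in>UNIV. h (X \<omega>) $ i * W \<omega> $ i - h (X \<omega>) $ i * \<gamma> $ i)" for \<omega>
    by (simp add: inner_vec_def right_diff_distrib)
  have hi [measurable]: "(\<lambda>x. h x $ i) \<in> borel_measurable N" for i by measurable
  have bi: "AE \<omega> in M. \<bar>h (X \<omega>) $ i\<bar> \<le> C" for i
    using bound by eventually_elim (rule order_trans[OF component_le_norm_cart])
  have intW: "integrable M (\<lambda>\<omega>. h (X \<omega>) $ i * W \<omega> $ i)"
    and eqW: "(\<integral>\<omega>. h (X \<omega>) $ i * W \<omega> $ i \<partial>M) = (\<integral>\<omega>. h (X \<omega>) $ i * \<gamma> $ i \<partial>M)" for i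
    by (rule integrable_mult_mean_independent[OF X hi integrable_nth(1) mean_indep bi]
        integral_mult_mean_independent[OF X hi integrable_nth(1) mean_indep bi])+
  have "integrable M (\<lambda>\<omega>. h (X \<omega>) $ i)" for i
    using bi[of i] by (intro integrable_const_bound[where B = C]) auto
  then have int1: "integrable M (\<lambda>\<omega>. h (X \<omega>) $ i * \<gamma> $ i)" for i
    by (rule integrable_mult_left)
  have int: "integrable M (\<lambda>\<omega>. h (X \<omega>) $ i * W \<omega> $ i - h (X \<omega>) $ i * \<gamma> $ i)" for i
    using intW int1 by (rule Bochner_Integration.integrable_diff)
  show "integrable M (\<lambda>\<omega>. h (X \<omega>) \<bullet> (W \<omega> - \<gamma>))"
    unfolding eq by (rule Bochner_Integration.integrable_sum) (rule int)
  have "(\<integral>\<omega>. h (X \<omega>) $ i * W \<omega> $ i - h (X \<omega>) $ i * \<gamma> $ i \<partial>M) = 0" for i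
    by (subst Bochner_Integration.integral_diff[OF intW int1]) (simp only: eqW diff_self)
  moreover have "(\<integral>\<omega>. h (X \<omega>) \<bullet> (W \<omega> - \<gamma>) \<partial>M) =
      (\<Sum>i\<in>UNIV. \<integral>\<omega>. h (X \<omega>) $ i * W \<omega> $ i - h (X \<omega>) $ i * \<gamma> $ i \<partial>M)"
    unfolding eq by (rule Bochner_Integration.integral_sum) (rule int)
  ultimately show "(\<integral>\<omega>. h (X \<omega>) \<bullet> (W \<omega> - \<gamma>) \<partial>M) = 0" by simp
qed

lemma integrable_annihilator: "integrable M (\<lambda>\<omega>. annihilator (A (X \<omega>)))"
proof (intro integrable_vecI integrable_const_bound[where B = 1] AE_I2)
qed (use abs_annihilator_entry_le in auto)

text \<open>The term \<open>A (X \<omega>) *v B \<omega>\<close> is annihilated before integrating,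
  so the integrand is dominated by \<open>norm (W \<omega>)\<close> because the annihilator is a
  contraction.\<close>

lemma
  shows integrable_annihilator_outcome:
      "integrable observation (\<lambda>(y, x). annihilator (A x) *v f y)"
    and normal_equation:
      "(\<integral>(y, x). annihilator (A x) *v f y \<partial>observation) =
       (\<integral>(y, x). annihilator (A x) \<partial>observation) *v \<gamma>"
proof -
  let ?Q = "\<lambda>\<omega>. annihilator (A (X \<omega>))"
  have ae: "AE \<omega> in M. ?Q \<omega> *v f (V \<omega>) = ?Q \<omega> *v W \<omega>"
    using regression
    by eventually_elim (simp add: matrix_vector_right_distrib annihilator_mult_image)
  have QW: "integrable M (\<lambda>\<omega>. ?Q \<omega> *v W \<omega>)"
    by (rule Bochner_Integration.integrable_bound[OF W])
      (auto simp: norm_annihilator_le)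
  have "integrable M (\<lambda>\<omega>. ?Q \<omega> *v f (V \<omega>))"
    by (rule integrable_cong_AE_imp[OF QW]) (use ae in \<open>auto elim: eventually_mono\<close>)
  then show "integrable observation (\<lambda>(y, x). annihilator (A x) *v f y)"
    by (subst integrable_distr_eq) (auto simp: split_def)
  have Q\<gamma>: "bounded_linear (\<lambda>Q :: real ^ 'r ^ 'r. Q *v \<gamma>)"
    by (intro linear_conv_bounded_linear[THEN iffD1] linearI)
      (simp_all add: matrix_vector_mult_add_rdistrib scaleR_matrix_vector_assoc)
  have "(\<integral>\<omega>. ?Q \<omega> *v W \<omega> \<partial>M) = (\<integral>\<omega>. ?Q \<omega> *v \<gamma> \<partial>M)"
  proof -
    have int: "integrable M (\<lambda>\<omega>. ?Q \<omega> *v (W \<omega> - \<gamma>))"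
      by (rule Bochner_Integration.integrable_bound[where f = "\<lambda>\<omega>. W \<omega> - \<gamma>"])
        (use W in \<open>auto simp: norm_annihilator_le\<close>)
    have zero: "(\<integral>\<omega>. ?Q \<omega> *v (W \<omega> - \<gamma>) \<partial>M) $ i = 0" for i
    proof -
      \<comment> \<open>Each row of the annihilator serves as the bounded weight \<open>h\<close>;
        its Euclidean norm is at most its l1 norm, a sum of \<open>CARD('r)\<close> entries of
        modulus at most 1.\<close>
      have "norm (annihilator (A x) $ i) \<le> real CARD('r)" for x
        using norm_le_l1_cart[of "annihilator (A x) $ i"]
          sum_bounded_above[of UNIV "\<lambda>j. \<bar>annihilator (A x) $ i $ j\<bar>" 1]
        by (simp add: abs_annihilator_entry_le)
      then have "(\<integral>\<omega>. annihilator (A (X \<omega>)) $ i \<bullet> (W \<omega> - \<gamma>) \<partial>M) = 0"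
        by (intro integral_weighted_error) auto
      then show ?thesis by (subst integral_vec_nth[OF int]) (simp add: matrix_mult_dot)
    qed
    have "(\<integral>\<omega>. ?Q \<omega> *v (W \<omega> - \<gamma>) \<partial>M) = (\<integral>\<omega>. ?Q \<omega> *v W \<omega> \<partial>M) - (\<integral>\<omega>. ?Q \<omega> *v \<gamma> \<partial>M)"
      using Bochner_Integration.integral_diff[OF QW
          integrable_bounded_linear[OF Q\<gamma> integrable_annihilator]]
      by (simp add: matrix_vector_mult_diff_distrib)
    moreover have "(\<integral>\<omega>. ?Q \<omega> *v (W \<omega> - \<gamma>) \<partial>M) = 0"
      using zero by (simp add: vec_eq_iff)
    ultimately show ?thesis by simp
  qed
  also have "\<dots> = (\<integral>\<omega>. ?Q \<omega> \<partial>M) *v \<gamma>"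
    by (rule integral_bounded_linear[OF Q\<gamma> integrable_annihilator])
  finally have "(\<integral>\<omega>. ?Q \<omega> *v f (V \<omega>) \<partial>M) = (\<integral>\<omega>. ?Q \<omega> \<partial>M) *v \<gamma>"
    using integral_cong_AE[OF _ _ ae] by simp
  then show "(\<integral>(y, x). annihilator (A x) *v f y \<partial>observation) =
       (\<integral>(y, x). annihilator (A x) \<partial>observation) *v \<gamma>"
    by (simp add: integral_distr split_def)
qed

text \<open>\<open>S\<close> is kept general to cover two cases: the estimable designs truncated at
  \<open>C\<close>, and all estimable designs when the weight is almost surely bounded on
  them.\<close>

lemma
  assumes S [measurable]: "S \<in> sets N"
    and image: "\<And>x. x \<in> S \<Longrightarrow> axis k 1 \<in> mat_image (transpose (A x))"
    and bound: "AE \<omega> in M. X \<omega> \<in> S \<longrightarrow> norm (coef_weight k (A (X \<omega>))) \<le> C"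
    and pos: "prob {\<omega> \<in> space M. X \<omega> \<in> S} > 0"
  shows integrable_score:
      "integrable (uniform_measure observation {(y, x) \<in> space observation. x \<in> S})
        (\<lambda>(y, x). axis k 1 \<bullet> (pinv (A x) *v (f y - \<gamma>)))"
    and cond_expectation_score:
      "cond_expectation observation
        (\<lambda>(y, x). axis k 1 \<bullet> (pinv (A x) *v (f y - \<gamma>))) {(y, x) \<in> space observation. x \<in> S} =
       cond_expectation M (\<lambda>\<omega>. B \<omega> $ k) {\<omega> \<in> space M. X \<omega> \<in> S}"
proof -
  interpret P: prob_space observation by (rule prob_space_distr) measurable
  let ?S = "{(y, x) \<in> space observation. x \<in> S}"
  let ?s = "\<lambda>(y, x). axis k 1 \<bullet> (pinv (A x) *v (f y - \<gamma>))"
  \<comment> \<open>Setting the weight to zero off \<open>S\<close> gives a function of the design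
    that is almost surely bounded without conditioning.\<close>
  define h where "h x = indicator S x *\<^sub>R coef_weight k (A x)" for x
  have [measurable]: "h \<in> borel_measurable N" unfolding h_def by measurable
  \<comment> \<open>The maximum with 0 covers a negative \<open>C\<close>, since off
    \<open>S\<close> the norm is 0.\<close>
  have bh: "AE \<omega> in M. norm (h (X \<omega>)) \<le> max C 0"
    using bound by eventually_elim (auto simp: h_def indicator_def)
  have "?S = space L \<times> S"
    using sets.sets_into_space[OF S] by (auto simp: space_pair_measure)
  then have Sm: "?S \<in> sets observation" by simp
  have sm: "?s \<in> borel_measurable observation" by measurable
  have mS: "measure observation ?S = prob {\<omega> \<in> space M. X \<omega> \<in> S}"
    by (subst measure_distr)
      (auto intro!: arg_cong[where f = prob] simp: space_pair_measure
        dest: measurable_space[OF X] measurable_space[OF V])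
  have ind: "indicator ?S (V \<omega>, X \<omega>) = (indicator S (X \<omega>) :: real)"
    and ind': "indicator {\<omega> \<in> space M. X \<omega> \<in> S} \<omega> = (indicator S (X \<omega>) :: real)"
    if "\<omega> \<in> space M" for \<omega>
    using that measurable_space[OF X that] measurable_space[OF V that]
    by (auto simp: indicator_def space_pair_measure)
  have Bk: "integrable M (\<lambda>\<omega>. indicator S (X \<omega>) * B \<omega> $ k)"
    by (rule Bochner_Integration.integrable_bound[OF integrable_nth(2)[of k]])
      (auto simp: indicator_def)
  \<comment> \<open>On \<open>S\<close> the score is
    \<open>q \<bullet> (A B) + q \<bullet> (W - \<gamma>)\<close>, whose first term is the
    coefficient; off \<open>S\<close> both sides vanish.\<close>
  have ae: "AE \<omega> in M. indicator ?S (V \<omega>, X \<omega>) * ?s (V \<omega>, X \<omega>) =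
      indicator S (X \<omega>) * B \<omega> $ k + h (X \<omega>) \<bullet> (W \<omega> - \<gamma>)"
    using regression AE_space
  proof eventually_elim
    case (elim \<omega>)
    have "?s (V \<omega>, X \<omega>) =
        coef_weight k (A (X \<omega>)) \<bullet> (A (X \<omega>) *v B \<omega>) + coef_weight k (A (X \<omega>)) \<bullet> (W \<omega> - \<gamma>)"
      using elim(1) by (simp add: inner_pinv_eq_coef_weight inner_diff_right inner_add_right)
    then show ?case
      unfolding ind[OF elim(2)] using image[of "X \<omega>"]
      by (cases "X \<omega> \<in> S") (simp_all only: h_def coef_weight_inner_mult indicator_simps
          mult_1 mult_zero_left scaleR_one scaleR_zero_left inner_zero_left add_0 simp_thms)
  qed
  have [measurable]: "(\<lambda>\<omega>. indicator ?S (V \<omega>, X \<omega>) * ?s (V \<omega>, X \<omega>)) \<in> borel_measurable M"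
    using measurable_compose[of "\<lambda>\<omega>. (V \<omega>, X \<omega>)" M "L \<Otimes>\<^sub>M N" "\<lambda>z. indicator ?S z * ?s z" borel]
      Sm sm by simp
  note int = Bochner_Integration.integrable_add[OF Bk integrable_weighted_error[OF _ bh]]
  have "integrable M (\<lambda>\<omega>. indicator ?S (V \<omega>, X \<omega>) * ?s (V \<omega>, X \<omega>))"
    by (rule integrable_cong_AE_imp[OF int]) (use ae in \<open>auto elim: eventually_mono\<close>)
  then have "integrable observation (\<lambda>z. indicator ?S z * ?s z)"
    by (subst integrable_distr_eq) (use Sm sm in auto)
  then show "integrable (uniform_measure observation ?S) ?s"
    using pos by (subst P.integrable_uniform_measure_iff[OF Sm _ sm]) (simp_all only: mS)
  have "(\<integral>z. indicator ?S z * ?s z \<partial>observation) =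
      (\<integral>\<omega>. indicator ?S (V \<omega>, X \<omega>) * ?s (V \<omega>, X \<omega>) \<partial>M)"
    by (rule integral_distr) (use Sm sm in auto)
  also have "\<dots> = (\<integral>\<omega>. indicator S (X \<omega>) * B \<omega> $ k + h (X \<omega>) \<bullet> (W \<omega> - \<gamma>) \<partial>M)"
    by (rule integral_cong_AE) (use ae in auto)
  also have "\<dots> = (\<integral>\<omega>. indicator S (X \<omega>) * B \<omega> $ k \<partial>M)"
    using Bk integrable_weighted_error[OF _ bh] integral_weighted_error[OF _ bh] by simp
  also have "\<dots> = (\<integral>\<omega>. indicator {\<omega> \<in> space M. X \<omega> \<in> S} \<omega> * B \<omega> $ k \<partial>M)"
    by (intro Bochner_Integration.integral_cong) (auto simp: ind')
  finally show "cond_expectation observation ?s ?S =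
      cond_expectation M (\<lambda>\<omega>. B \<omega> $ k) {\<omega> \<in> space M. X \<omega> \<in> S}"
    using pos P.cond_expectation_eq[OF Sm _ sm, unfolded mS, OF pos]
      cond_expectation_eq[of "{\<omega> \<in> space M. X \<omega> \<in> S}" "\<lambda>\<omega>. B \<omega> $ k"]
    by simp
qed

text \<open>For fixed \<open>\<omega>\<close> the truncated indicator is constant once
  \<open>C \<ge> \<rho> (X \<omega>)\<close>. Dominated convergence then handles the numerator and
  the denominator of the conditional expectation separately.\<close>

lemma tendsto_cond_expectation_truncated:
  fixes \<phi> :: "'w \<Rightarrow> real" and \<rho> :: "'x \<Rightarrow> real"
  assumes \<phi>: "integrable M \<phi>" and S [measurable]: "S \<in> sets N"
    and \<rho> [measurable]: "\<rho> \<in> borel_measurable N"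
    and pos: "prob {\<omega> \<in> space M. X \<omega> \<in> S} > 0"
  shows "((\<lambda>C. prob {\<omega> \<in> space M. X \<omega> \<in> {x \<in> S. \<rho> x \<le> C}})
           \<longlongrightarrow> prob {\<omega> \<in> space M. X \<omega> \<in> S}) at_top" (is "(?p \<longlongrightarrow> ?q) _")
    and "((\<lambda>C. cond_expectation M \<phi> {\<omega> \<in> space M. X \<omega> \<in> {x \<in> S. \<rho> x \<le> C}})
           \<longlongrightarrow> cond_expectation M \<phi> {\<omega> \<in> space M. X \<omega> \<in> S}) at_top"
proof -
  let ?E = "{\<omega> \<in> space M. X \<omega> \<in> S}"
  let ?F = "\<lambda>C. {\<omega> \<in> space M. X \<omega> \<in> {x \<in> S. \<rho> x \<le> C}}"
  have SS: "{x \<in> S. \<rho> x \<le> C} \<in> sets N" for C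
  proof -
    have "{x \<in> space N. x \<in> S \<and> \<rho> x \<le> C} \<in> sets N" by measurable
    also have "{x \<in> space N. x \<in> S \<and> \<rho> x \<le> C} = {x \<in> S. \<rho> x \<le> C}"
      using sets.sets_into_space[OF S] by auto
    finally show ?thesis .
  qed
  have FM [measurable]: "?F C \<in> sets M" for C using SS by measurable
  have conv: "((\<lambda>C. \<integral>\<omega>. indicator (?F C) \<omega> * \<psi> \<omega> \<partial>M) \<longlongrightarrow> (\<integral>\<omega>. indicator ?E \<omega> * \<psi> \<omega> \<partial>M)) at_top"
    if \<psi>: "integrable M \<psi>" for \<psi> :: "'w \<Rightarrow> real"
  proof (rule integral_dominated_convergence_at_top[where w = "\<lambda>\<omega>. \<bar>\<psi> \<omega>\<bar>"])
    show "AE \<omega> in M. ((\<lambda>C. indicator (?F C) \<omega> * \<psi> \<omega>) \<longlongrightarrow> indicator ?E \<omega> * \<psi> \<omega>) at_top"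
    proof (intro AE_I2 tendsto_eventually)
      fix \<omega> assume "\<omega> \<in> space M"
      show "\<forall>\<^sub>F C in at_top. indicator (?F C) \<omega> * \<psi> \<omega> = indicator ?E \<omega> * \<psi> \<omega>"
        using eventually_ge_at_top[of "\<rho> (X \<omega>)"]
        by eventually_elim (auto simp: indicator_def)
    qed
  qed (use \<psi> in \<open>auto simp: indicator_def intro!: always_eventually\<close>)
  \<comment> \<open>The denominator is the case of the constant integrand 1.\<close>
  show p: "(?p \<longlongrightarrow> ?q) at_top" using conv[of "\<lambda>_. 1"] by simp
  \<comment> \<open>The quotient form of the conditional expectation requires positive probability,
    which holds for all large \<open>C\<close>.\<close>
  have "\<forall>\<^sub>F C in at_top. ?p C > 0" using p pos by (rule order_tendstoD)
  then have "\<forall>\<^sub>F C in at_top.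
      (\<integral>\<omega>. indicator (?F C) \<omega> * \<phi> \<omega> \<partial>M) / ?p C = cond_expectation M \<phi> (?F C)"
    by eventually_elim (use \<phi> in \<open>simp only: cond_expectation_eq[OF FM] borel_measurable_integrable\<close>)
  moreover have "((\<lambda>C. (\<integral>\<omega>. indicator (?F C) \<omega> * \<phi> \<omega> \<partial>M) / ?p C)
      \<longlongrightarrow> cond_expectation M \<phi> ?E) at_top"
    using tendsto_divide[OF conv[OF \<phi>] p] pos \<phi> by (subst cond_expectation_eq) auto
  ultimately show "((\<lambda>C. cond_expectation M \<phi> (?F C)) \<longlongrightarrow> cond_expectation M \<phi> ?E) at_top"
    by (rule Lim_transform_eventually[rotated])
qed

end

section \<open>The panel\<close>

text \<open>A path outside the support lies in a null box with rational centre and radius, and there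
  are countably many such boxes. This is what allows the model, assumed for paths in the support, to
  be evaluated at the realized path.\<close>

lemma (in finite_measure) AE_treatment_path_in_support:
  assumes D: "\<And>t. t \<in> {1..T} \<Longrightarrow> D g t \<in> borel_measurable M"
  shows "AE \<omega> in M. treatment_path T D g \<omega> \<in> path_support M T D g"
proof -
  define U where "U p = {\<omega> \<in> space M. \<forall>t\<in>{1..T}. \<bar>D g t \<omega> - fst p t\<bar> < snd p}" for p :: "path \<times> real"
  have U [measurable]: "U p \<in> sets M" for p
    unfolding U_def using D by measurable
  define R where "R = {p \<in> PiE {1..T} (\<lambda>_. \<rat>) \<times> \<rat>. measure M (U p) = 0}"
  have "countable (PiE {1..T} (\<lambda>_. \<rat> :: real set) \<times> (\<rat> :: real set))"
    by (intro countable_SIGMA countable_PiE countable_rat) auto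
  then have "countable R" unfolding R_def by (rule countable_subset[rotated]) auto
  moreover have "AE \<omega> in M. \<omega> \<notin> U p" if "p \<in> R" for p
    using that by (intro AE_not_in null_setsI U) (simp add: R_def emeasure_eq_measure)
  ultimately have "AE \<omega> in M. \<forall>p\<in>R. \<omega> \<notin> U p" by (simp add: AE_ball_countable)
  then show ?thesis using AE_space
  proof eventually_elim
    case (elim \<omega>)
    have "measure M {\<omega>' \<in> space M. \<forall>t\<in>{1..T}. \<bar>D g t \<omega>' - treatment_path T D g \<omega> t\<bar> < \<epsilon>} > 0"
      (is "measure M ?V > 0") if "\<epsilon> > 0" for \<epsilon>
    proof (rule ccontr)
      assume "\<not> measure M ?V > 0"
      then have V: "measure M ?V = 0" using measure_nonneg[of M ?V] by linarith
      \<comment> \<open>With \<open>\<delta> < \<epsilon> / 2\<close>, the triangle inequality puts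
        any \<open>\<delta>\<close>-box containing the realized path inside the
        \<open>\<epsilon>\<close>-box around that path.\<close>
      obtain \<delta> where \<delta>: "\<delta> \<in> \<rat>" "0 < \<delta>" "\<delta> < \<epsilon> / 2"
        using Rats_dense_in_real[of 0 "\<epsilon> / 2"] \<open>\<epsilon> > 0\<close> by auto
      have "\<exists>q\<in>\<rat>. \<bar>D g t \<omega> - q\<bar> < \<delta>" for t
      proof -
        obtain q where "q \<in> \<rat>" "D g t \<omega> - \<delta> < q" "q < D g t \<omega>"
          using Rats_dense_in_real[of "D g t \<omega> - \<delta>" "D g t \<omega>"] \<open>0 < \<delta>\<close> by auto
        then show ?thesis by (intro bexI[of _ q]) auto
      qed
      then obtain q where q: "\<And>t. q t \<in> \<rat>" "\<And>t. \<bar>D g t \<omega> - q t\<bar> < \<delta>" by metis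
      let ?p = "(restrict q {1..T}, \<delta>)"
      have "U ?p \<subseteq> ?V"
      proof
        fix \<omega>' assume "\<omega>' \<in> U ?p"
        moreover have "\<bar>D g t \<omega>' - D g t \<omega>\<bar> < \<epsilon>" if "\<bar>D g t \<omega>' - q t\<bar> < \<delta>" for t
          using that q(2)[of t] \<delta>(3) by linarith
        ultimately show "\<omega>' \<in> ?V" by (simp add: U_def treatment_path_def)
      qed
      moreover have "?V \<in> sets M" using D by measurable
      ultimately have "measure M (U ?p) \<le> measure M ?V" by (rule finite_measure_mono)
      then have "?p \<in> R" using V q(1) \<delta>(1) by (auto simp: R_def intro: antisym)
      moreover have "\<omega> \<in> U ?p" using q(2) elim by (simp add: U_def)
      ultimately show False using elim by blast
    qed
    then show ?case
      by (auto simp: path_support_def path_space_def space_PiM treatment_path_def)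
  qed
qed

lemma measurable_fdiff:
  assumes "t \<in> {2..T}"
  shows "(\<lambda>d. fdiff d t) \<in> borel_measurable (path_space T)"
  unfolding fdiff_def path_space_def
  using assms by (intro borel_measurable_diff measurable_component_singleton) auto

text \<open>Turns the assumed second moments into integrability.\<close>

lemma abs_le_one_plus_square: "\<bar>w\<bar> \<le> 1 + w\<^sup>2" for w :: real
proof -
  have "0 \<le> (\<bar>w\<bar> - 1)\<^sup>2" by simp
  then have "2 * \<bar>w\<bar> \<le> 1 + w\<^sup>2" by (simp add: power2_diff)
  then show ?thesis using zero_le_power2[of w] by linarith
qed

theorem theorem4:
  fixes M :: "'w measure"
    and T K g :: nat
    and Y :: "nat \<Rightarrow> nat \<Rightarrow> path \<Rightarrow> 'w \<Rightarrow> real"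
    and D :: "nat \<Rightarrow> nat \<Rightarrow> 'w \<Rightarrow> real"
    and \<D> :: "path set"
    and B :: "'w \<Rightarrow> real ^ 'c"
    and period :: "'r::finite \<Rightarrow> nat"
    and lag :: "'c::finite \<Rightarrow> nat"
  assumes prob: "prob_space M"
    and KT: "K + 1 < T"
    and period: "bij_betw period UNIV {K + 2..T}"
    and lag: "bij_betw lag UNIV {0..K}"
    and g: "g \<ge> 1"
    and support: "\<And>h. h \<ge> 1 \<Longrightarrow> path_support M T D h = \<D>"
    and observed: "\<And>t. t \<in> {1..T} \<Longrightarrow>
          (\<lambda>\<omega>. Y g t (treatment_path T D g \<omega>) \<omega>) \<in> borel_measurable M"
    and no_anticipation: "\<And>h. h \<ge> 1 \<Longrightarrow>
          AE \<omega> in M. \<forall>t\<in>{1..<T}. \<forall>d\<in>insert (zero_path T) \<D>. \<forall>d'\<in>insert (zero_path T) \<D>.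
            (\<forall>s\<in>{1..t}. d s = d' s) \<longrightarrow> Y h t d \<omega> = Y h t d' \<omega>"
    and independent:
          "prob_space.indep_vars M (\<lambda>_. group_space T \<D>) (group_data T \<D> Y D) {1..}"
    and identically_distributed: "\<And>h h'. h \<ge> 1 \<Longrightarrow> h' \<ge> 1 \<Longrightarrow>
          distr M (group_space T \<D>) (group_data T \<D> Y D h) =
          distr M (group_space T \<D>) (group_data T \<D> Y D h')"
    and parallel_trends: "\<And>t. t \<in> {2..T} \<Longrightarrow>
          AE \<omega> in M.
            real_cond_exp M (vimage_algebra (space M) (treatment_path T D g) (path_space T))
              (\<lambda>\<omega>. Y g t (zero_path T) \<omega> - Y g (t - 1) (zero_path T) \<omega>) \<omega> =
            (\<integral>\<omega>. Y g t (zero_path T) \<omega> - Y g (t - 1) (zero_path T) \<omega> \<partial>M)"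
    and B_measurable: "B \<in> borel_measurable M"
    and B_square_integrable: "integrable M (\<lambda>\<omega>. (norm (B \<omega>))\<^sup>2)"
    and random_coefficients:
          "AE \<omega> in M. \<forall>t\<in>{1..T}. \<forall>d\<in>\<D>.
             Y g t d \<omega> = Y g t (zero_path T) \<omega>
               + (\<Sum>k | lag k \<le> min K (t - 1). B \<omega> $ k * d (t - lag k))"
    and design: "invertible
          (\<integral>\<omega>. annihilator (design_matrix period lag (treatment_path T D g \<omega>)) \<partial>M)"
    and moments: "\<And>t. t \<in> {2..T} \<Longrightarrow>
          integrable M (\<lambda>\<omega>. (D g t \<omega> - D g (t - 1) \<omega>)\<^sup>2
            + (Y g t (zero_path T) \<omega> - Y g (t - 1) (zero_path T) \<omega>)\<^sup>2)"
  shows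
    "let P = obs_law M T Y D g;
         \<Gamma> = Gamma_param M T Y g period
     in
       (integrable P (\<lambda>(y, d). annihilator (design_matrix period lag d) *v diff_vec period y) \<and>
        \<Gamma> = matrix_inv (\<integral>(y, d). annihilator (design_matrix period lag d) \<partial>P)
              *v (\<integral>(y, d). annihilator (design_matrix period lag d) *v diff_vec period y \<partial>P)) \<and>
       (\<forall>k. measure M {\<omega> \<in> space M. lag_estimable period lag k (treatment_path T D g \<omega>)} > 0 \<longrightarrow>
          (let A = {(y, d) \<in> space P. lag_estimable period lag k d};
               A\<^sub>C = (\<lambda>C. {(y, d) \<in> space P. lag_estimable period lag k d \<and>
                        norm (pinv (transpose (design_matrix period lag d)) *v axis k 1) \<le> C});
               score = (\<lambda>(y, d). lag_score period lag k \<Gamma> y d)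
           in
             (\<forall>C. measure P (A\<^sub>C C) > 0 \<longrightarrow> integrable (uniform_measure P (A\<^sub>C C)) score) \<and>
             ((\<lambda>C. cond_expectation P score (A\<^sub>C C)) \<longlongrightarrow> beta_bar M T D B g period lag k) at_top \<and>
             ((\<forall>t\<in>{1..T}. \<exists>S. finite S \<and> (AE \<omega> in M. D g t \<omega> \<in> S)) \<longrightarrow>
                integrable (uniform_measure P A) score \<and>
                beta_bar M T D B g period lag k = cond_expectation P score A)))"
proof -
  interpret prob_space M by (rule prob)
  let ?X = "treatment_path T D g" and ?V = "outcome_path T Y D g"
  let ?A = "design_matrix period lag" and ?N = "path_space T"
  let ?Y0 = "\<lambda>t \<omega>. Y g t (zero_path T) \<omega>"
  define W where "W \<omega> = (\<chi> i. ?Y0 (period i) \<omega> - ?Y0 (period i - 1) \<omega>)" for \<omega>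
  define \<Gamma> where "\<Gamma> = Gamma_param M T Y g period"
  have per: "period i \<in> {K + 2..T}" for i using bij_betwE[OF period] by blast
  have lagK: "lag j \<le> K" for j using bij_betwE[OF lag] by force

  \<comment> \<open>Measurability of treatments, outcomes and design\<close>
  have data: "group_data T \<D> Y D g \<in> M \<rightarrow>\<^sub>M group_space T \<D>"
    using independent g by (auto simp: indep_vars_def)
  have X [measurable]: "?X \<in> M \<rightarrow>\<^sub>M ?N"
    using measurable_compose[OF data[unfolded group_space_def] measurable_snd]
    by (simp add: group_data_def)
  have Y0 [measurable]: "?Y0 t \<in> borel_measurable M" if "t \<in> {1..T}" for t
  proof -
    \<comment> \<open>The never-treated outcome is a coordinate of the group data because the zero
      path was added to the index set.\<close>
    have "(\<lambda>\<omega>. fst (group_data T \<D> Y D g \<omega>) (t, zero_path T)) \<in> borel_measurable M"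
      using measurable_compose[OF data[unfolded group_space_def] measurable_fst]
      by (rule measurable_compose[OF _ measurable_component_singleton]) (use that in simp)
    then show ?thesis using that by (simp add: group_data_def)
  qed
  have D: "D g t \<in> borel_measurable M" if "t \<in> {1..T}" for t
  proof -
    have "(\<lambda>\<omega>. ?X \<omega> t) \<in> borel_measurable M"
      using X unfolding path_space_def
      by (rule measurable_compose[OF _ measurable_component_singleton]) (rule that)
    then show ?thesis using that by (simp add: treatment_path_def)
  qed
  have V: "?V \<in> M \<rightarrow>\<^sub>M ?N"
    unfolding path_space_def outcome_path_def by (intro measurable_restrict observed)
  have A: "?A \<in> borel_measurable ?N"
    unfolding design_matrix_def
  proof (intro borel_measurable_vec_lambda measurable_fdiff)
    \<comment> \<open>Periods start at \<open>K + 2\<close> and lags stop at \<open>K\<close>, so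
      the subtraction is never truncated and the preceding period is still observed.\<close>
    show "period i - lag j \<in> {2..T}" for i j using per[of i] lagK[of j] by auto
  qed
  have f: "diff_vec period \<in> borel_measurable ?N"
    unfolding diff_vec_def
  proof (intro borel_measurable_vec_lambda measurable_fdiff)
    show "period i \<in> {2..T}" for i using per[of i] by auto
  qed

  \<comment> \<open>Integrability and mean independence\<close>
  have W_int: "integrable M W"
  proof (rule integrable_vecI)
    fix i
    let ?w = "\<lambda>\<omega>. ?Y0 (period i) \<omega> - ?Y0 (period i - 1) \<omega>"
    let ?m = "\<lambda>\<omega>. 1 + ((D g (period i) \<omega> - D g (period i - 1) \<omega>)\<^sup>2 + (?w \<omega>)\<^sup>2)"
    have "integrable M ?w"
    proof (rule Bochner_Integration.integrable_bound)
      show "integrable M ?m" using moments[of "period i"] per[of i] by simp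
      show "?w \<in> borel_measurable M" using per[of i] by (intro borel_measurable_diff Y0) auto
      have "\<bar>w\<bar> \<le> 1 + (d\<^sup>2 + w\<^sup>2)" for d w :: real
        using abs_le_one_plus_square[of w] zero_le_power2[of d] by linarith
      then show "AE \<omega> in M. norm (?w \<omega>) \<le> norm (?m \<omega>)"
        by (simp add: abs_of_nonneg)
    qed
    then show "integrable M (\<lambda>\<omega>. W \<omega> $ i)" by (simp add: W_def)
  qed
  have B_int: "integrable M B"
  proof (rule Bochner_Integration.integrable_bound)
    show "integrable M (\<lambda>\<omega>. 1 + (norm (B \<omega>))\<^sup>2)" using B_square_integrable by simp
    show "AE \<omega> in M. norm (B \<omega>) \<le> norm (1 + (norm (B \<omega>))\<^sup>2)"
      using abs_le_one_plus_square[of "norm (B _)"] by simp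
  qed (rule B_measurable)
  have mean_indep: "AE \<omega> in M.
      real_cond_exp M (vimage_algebra (space M) ?X ?N) (\<lambda>\<omega>. W \<omega> $ i) \<omega> = \<Gamma> $ i" for i
    using parallel_trends[of "period i"] per[of i] by (simp add: W_def \<Gamma>_def Gamma_param_def)

  \<comment> \<open>The differenced regression equation\<close>
  have "AE \<omega> in M. ?X \<omega> \<in> path_support M T D g"
    using D by (rule AE_treatment_path_in_support)
  then have regression: "AE \<omega> in M. diff_vec period (?V \<omega>) = W \<omega> + ?A (?X \<omega>) *v B \<omega>"
    using random_coefficients
  proof eventually_elim
    case (elim \<omega>)
    let ?d = "?X \<omega>"
    have Yd: "Y g t ?d \<omega> = ?Y0 t \<omega> + (\<Sum>k\<in>UNIV. B \<omega> $ k * ?d (t - lag k))"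
      if "t \<in> {K + 1..T}" for t
    proof -
      \<comment> \<open>From period \<open>K + 1\<close> on, all \<open>K + 1\<close> lags are
        active. A row compares \<open>period i\<close> with \<open>period i - 1\<close>, hence the
        first row is at \<open>K + 2\<close>.\<close>
      have "{k. lag k \<le> min K (t - 1)} = UNIV"
      proof -
        have "lag k \<le> min K (t - 1)" for k using lagK[of k] that by auto
        then show ?thesis by blast
      qed
      moreover have "?d \<in> \<D>" using elim(1) support[OF g] by simp
      ultimately show ?thesis using elim(2) that by simp
    qed
    show ?case
    proof (rule vec_eq_iff[THEN iffD2], rule allI)
      fix i
      have "diff_vec period (?V \<omega>) $ i = Y g (period i) ?d \<omega> - Y g (period i - 1) ?d \<omega>"
        using per[of i] by (auto simp: diff_vec_def fdiff_def outcome_path_def)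
      also have "\<dots> = W \<omega> $ i + (\<Sum>k\<in>UNIV. B \<omega> $ k * ?d (period i - lag k))
          - (\<Sum>k\<in>UNIV. B \<omega> $ k * ?d (period i - 1 - lag k))"
      proof -
        have "period i \<in> {K + 1..T}" "period i - 1 \<in> {K + 1..T}" using per[of i] by auto
        then show ?thesis by (simp add: Yd W_def del: One_nat_def)
      qed
      \<comment> \<open>Exchanging the two subtractions, \<open>period i - 1 - lag k\<close> becomes
        \<open>period i - lag k - 1\<close>, so the sums differ by first differences of the
        treatment.\<close>
      also have "\<dots> = (W \<omega> + ?A ?d *v B \<omega>) $ i"
        by (simp add: matrix_vector_mult_def design_matrix_def fdiff_def diff_commute[of _ 1]
            sum_subtractf right_diff_distrib mult.commute)
      finally show "diff_vec period (?V \<omega>) $ i = (W \<omega> + ?A ?d *v B \<omega>) $ i" .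
    qed
  qed
  interpret R: random_coefficient_regression M ?N ?X ?A ?N ?V "diff_vec period" W \<Gamma> B
    by unfold_locales (fact X A V f W_int B_int mean_indep regression)+

  \<comment> \<open>Identification of the trends\<close>
  let ?P = "obs_law M T Y D g"
  have P: "?P = R.observation" by (simp add: obs_law_def)
  have intA: "(\<integral>(y, d). annihilator (?A d) \<partial>?P) = (\<integral>\<omega>. annihilator (?A (?X \<omega>)) \<partial>M)"
    unfolding P using X V A by (subst integral_distr) (simp_all add: split_def)
  let ?E = "\<integral>(y, d). annihilator (?A d) \<partial>?P"
  \<comment> \<open>The change of variables \<open>intA\<close> carries the invertibility assumption
    over to the law of the observables.\<close>
  have "matrix_inv ?E ** ?E = mat 1"
    using design unfolding intA invertible_def matrix_inv_def by (rule someI2_ex) blast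
  then have Gamma: "\<Gamma> = matrix_inv ?E *v (\<integral>(y, d). annihilator (?A d) *v diff_vec period y \<partial>?P)"
    using R.normal_equation by (simp add: P matrix_vector_mul_assoc)

  \<comment> \<open>Identification of the mean coefficients\<close>
  have main: "(\<forall>C. measure ?P (AC C) > 0 \<longrightarrow> integrable (uniform_measure ?P (AC C)) score) \<and>
      ((\<lambda>C. cond_expectation ?P score (AC C)) \<longlongrightarrow> beta_bar M T D B g period lag k) at_top \<and>
      ((\<forall>t\<in>{1..T}. \<exists>S. finite S \<and> (AE \<omega> in M. D g t \<omega> \<in> S)) \<longrightarrow>
        integrable (uniform_measure ?P AA) score \<and>
        beta_bar M T D B g period lag k = cond_expectation ?P score AA)"
    if pos: "measure M {\<omega> \<in> space M. lag_estimable period lag k (?X \<omega>)} > 0"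
      and AA: "AA = {(y, d) \<in> space ?P. lag_estimable period lag k d}"
      and AC: "AC = (\<lambda>C. {(y, d) \<in> space ?P. lag_estimable period lag k d \<and>
        norm (pinv (transpose (?A d)) *v axis k 1) \<le> C})"
      and score: "score = (\<lambda>(y, d). lag_score period lag k \<Gamma> y d)"
    for k AA AC score
  proof -
    define S where "S = {d \<in> space ?N. lag_estimable period lag k d}"
    define \<rho> where "\<rho> d = norm (coef_weight k (?A d))" for d
    define SC where "SC C = {d \<in> S. \<rho> d \<le> C}" for C
    have \<rho> [measurable]: "\<rho> \<in> borel_measurable ?N" unfolding \<rho>_def using A by measurable
    have S [measurable]: "S \<in> sets ?N"
      unfolding S_def lag_estimable_def mem_mat_image_iff using A by measurable
    have "SC C = {d \<in> space ?N. d \<in> S \<and> \<rho> d \<le> C}" for C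
      unfolding SC_def S_def by blast
    then have SC [measurable]: "SC C \<in> sets ?N" for C by simp
    have spX: "?X \<omega> \<in> space ?N" if "\<omega> \<in> space M" for \<omega> using measurable_space[OF X that] .
    have spP: "space ?P = space ?N \<times> space ?N" by (simp add: P space_pair_measure)
    have AA': "AA = {(y, d) \<in> space R.observation. d \<in> S}"
      unfolding AA P[symmetric] spP S_def by auto
    have AC': "AC C = {(y, d) \<in> space R.observation. d \<in> SC C}" for C
      unfolding AC P[symmetric] spP SC_def S_def \<rho>_def coef_weight_def by auto
    have score': "score = (\<lambda>(y, d). axis k 1 \<bullet> (pinv (?A d) *v (diff_vec period y - \<Gamma>)))"
      unfolding score lag_score_def by simp
    have ES: "{\<omega> \<in> space M. lag_estimable period lag k (?X \<omega>)} = {\<omega> \<in> space M. ?X \<omega> \<in> S}"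
      using spX by (auto simp: S_def)
    have posS: "prob {\<omega> \<in> space M. ?X \<omega> \<in> S} > 0" using pos by (simp add: ES)
    have beta: "beta_bar M T D B g period lag k =
        cond_expectation M (\<lambda>\<omega>. B \<omega> $ k) {\<omega> \<in> space M. ?X \<omega> \<in> S}"
      by (simp add: beta_bar_def ES)
    have im: "axis k 1 \<in> mat_image (transpose (?A d))" if "d \<in> S" for d
      using that by (simp add: S_def lag_estimable_def)
    have bnd: "AE \<omega> in M. ?X \<omega> \<in> SC C \<longrightarrow> norm (coef_weight k (?A (?X \<omega>))) \<le> C" for C
      by (simp add: SC_def \<rho>_def)
    have imC: "axis k 1 \<in> mat_image (transpose (?A d))" if "d \<in> SC C" for d C
      using that im by (simp add: SC_def)
    have measAC: "measure ?P (AC C) = prob {\<omega> \<in> space M. ?X \<omega> \<in> SC C}" for C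
    proof -
      have "AC C = space ?N \<times> SC C"
        using sets.sets_into_space[OF SC, of C] by (auto simp: AC' space_pair_measure)
      then show ?thesis
        unfolding P using X V measurable_space[OF V]
        by (subst measure_distr) (auto intro!: arg_cong[where f = prob])
    qed
    note lim = R.tendsto_cond_expectation_truncated[OF R.integrable_nth(2)[of k] S \<rho> posS,
        folded SC_def]
    have int: "\<forall>C. measure ?P (AC C) > 0 \<longrightarrow> integrable (uniform_measure ?P (AC C)) score"
    proof (intro allI impI)
      fix C assume "measure ?P (AC C) > 0"
      then have "prob {\<omega> \<in> space M. ?X \<omega> \<in> SC C} > 0" by (simp only: measAC)
      then show "integrable (uniform_measure ?P (AC C)) score"
        unfolding AC' P score' by (intro R.integrable_score[OF SC _ bnd] imC)
    qed
    \<comment> \<open>For such \<open>C\<close> the score identity holds on the truncated event, so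
      the limit of the coefficient means transfers to the scores.\<close>
    have "\<forall>\<^sub>F C in at_top. prob {\<omega> \<in> space M. ?X \<omega> \<in> SC C} > 0"
      using lim(1) posS by (rule order_tendstoD)
    then have "\<forall>\<^sub>F C in at_top. cond_expectation M (\<lambda>\<omega>. B \<omega> $ k) {\<omega> \<in> space M. ?X \<omega> \<in> SC C} =
        cond_expectation ?P score (AC C)"
    proof eventually_elim
      case (elim C)
      then show ?case
        unfolding AC' P score' by (intro R.cond_expectation_score[OF SC _ bnd, symmetric] imC)
    qed
    then have limit: "((\<lambda>C. cond_expectation ?P score (AC C)) \<longlongrightarrow> beta_bar M T D B g period lag k) at_top"
      unfolding beta using lim(2) by (rule Lim_transform_eventually[rotated])
    have fin: "integrable (uniform_measure ?P AA) score \<and>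
        beta_bar M T D B g period lag k = cond_expectation ?P score AA"
      if "\<forall>t\<in>{1..T}. \<exists>S. finite S \<and> (AE \<omega> in M. D g t \<omega> \<in> S)"
    proof -
      from that obtain F where F: "\<And>t. t \<in> {1..T} \<Longrightarrow> finite (F t)"
        "\<And>t. t \<in> {1..T} \<Longrightarrow> AE \<omega> in M. D g t \<omega> \<in> F t" by metis
      have "AE \<omega> in M. \<forall>t\<in>{1..T}. D g t \<omega> \<in> F t" using F(2) by (simp add: AE_finite_all)
      \<comment> \<open>Almost surely the path lies in a finite product set, so the largest weight
        norm over that set is a bound and no truncation is required.\<close>
      then have "AE \<omega> in M. ?X \<omega> \<in> S \<longrightarrow> norm (coef_weight k (?A (?X \<omega>))) \<le> Max (\<rho> ` PiE {1..T} F)"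
      proof eventually_elim
        case (elim \<omega>)
        then have "?X \<omega> \<in> PiE {1..T} F" by (auto simp: treatment_path_def)
        moreover have "finite (PiE {1..T} F)" using F(1) by (intro finite_PiE) auto
        ultimately have "\<rho> (?X \<omega>) \<le> Max (\<rho> ` PiE {1..T} F)" by (intro Max_ge) auto
        then show ?case by (simp add: \<rho>_def)
      qed
      from R.integrable_score[OF S im this posS] R.cond_expectation_score[OF S im this posS]
      show ?thesis by (simp add: AA' P score' beta)
    qed
    show ?thesis using int limit fin by blast
  qed
  show ?thesis
    unfolding Let_def \<Gamma>_def[symmetric]
    using R.integrable_annihilator_outcome[folded P] Gamma main[OF _ refl refl refl] by blast
qed

end
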